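(* Let $X$ be a Banach space, $U\subset X$ open, and $\varphi:U\to\mathbb{R}$ a function. Suppose that $\varphi$ attains a local extremum at a point $x_0\in U$, and that $J\varphi(x_0)\subset X^*$ is a pseudo-Jacobian of $\varphi$ at $x_0$. Then $$0\in\overline{\mathrm{co}}^{\,w^*}\bigl(J\varphi(x_0)\bigr),$$ the weak$^*$-closed convex hull of $J\varphi(x_0)$ in $X^*$.
   Context: Banach spaces are real; $\mathcal{L}(X,Y)$ is the space of bounded linear operators from $X$ to $Y$. For $\varphi:U\to\mathbb{R}$ with $U\subset X$ open, $x\in U$ and $v\in X$, $\varphi'_{+}(x;v)=\limsup_{t\to0^+}\frac{\varphi(x+tv)-\varphi(x)}{t}$. For a map $f:U\to Y$ into a Banach space $Y$ and $x\in U$, a nonempty set $Jf(x)\subset\mathcal{L}(X,Y)$ is a pseudo-Jacobian of $f$ at $x$ if $(y^*\circ f)'_{+}(x;v)\le\sup\{\langle y^*,T(v)\rangle : T\in Jf(x)\}$ for all $y^*\in Y^*$ and $v\in X$. For real-valued functions $Y=\mathbb{R}$ and $\mathcal{L}(X,\mathbb{R})=X^*$. *)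

theory Defs
  imports "HOL-Analysis.Analysis"
begin

text \<open>
  The upper right Dini directional derivative is a limsup of real quotients that may be infinite,
  so it takes values in \<^typ>\<open>ereal\<close>. A function on an open set \<open>U\<close> is represented by a total
  function; at a point of \<open>U\<close> the limsup depends only on the values on \<open>U\<close>, because
  \<open>x + t *\<^sub>R v \<in> U\<close> for all small \<open>t\<close>.
\<close>

definition upper_dini :: "('a::real_normed_vector \<Rightarrow> real) \<Rightarrow> 'a \<Rightarrow> 'a \<Rightarrow> ereal" where
  "upper_dini \<phi> x v = Limsup (at_right 0) (\<lambda>t::real. ereal ((\<phi> (x + t *\<^sub>R v) - \<phi> x) / t))"

definition pseudo_Jacobian ::
  "('a::banach \<Rightarrow> 'b::banach) \<Rightarrow> 'a \<Rightarrow> ('a \<Rightarrow>\<^sub>L 'b) set \<Rightarrow> bool" where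
  "pseudo_Jacobian f x J \<longleftrightarrow> J \<noteq> {} \<and>
     (\<forall>(y :: 'b \<Rightarrow>\<^sub>L real) v.
        upper_dini (blinfun_apply y \<circ> f) x v
          \<le> (SUP T\<in>J. ereal (blinfun_apply y (blinfun_apply T v))))"

definition local_extremum_on :: "('a::topological_space \<Rightarrow> real) \<Rightarrow> 'a set \<Rightarrow> 'a \<Rightarrow> bool" where
  "local_extremum_on \<phi> U x0 \<longleftrightarrow>
     (\<forall>\<^sub>F x in at x0 within U. \<phi> x0 \<le> \<phi> x) \<or> (\<forall>\<^sub>F x in at x0 within U. \<phi> x \<le> \<phi> x0)"

text \<open>For scalar-valued operators the strong operator topology is the topology of pointwise
  convergence on the dual space.\<close>

abbreviation weak_star_topology :: "('a::real_normed_vector \<Rightarrow>\<^sub>L real) topology" where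
  "weak_star_topology \<equiv> strong_operator_topology"

definition weak_star_closed_convex_hull ::
  "('a::real_normed_vector \<Rightarrow>\<^sub>L real) set \<Rightarrow> ('a \<Rightarrow>\<^sub>L real) set" where
  "weak_star_closed_convex_hull S = weak_star_topology closure_of (convex hull S)"

end

theory Submission
  imports Defs
begin

text \<open>
  Let \<open>K\<close> be the convex hull of \<open>J\<close>. At a local minimum every difference quotient of \<open>\<phi>\<close> is
  eventually nonnegative, so the pseudo-Jacobian inequality for \<open>y = id\<close> says that the support
  function of \<open>J\<close> is nonnegative: \<open>0 \<le> (SUP T\<in>J. T v)\<close> for every \<open>v\<close>
  (\<open>local_min_SUP_nonneg\<close>). At a local maximum the same argument applies to \<open>- \<phi>\<close>, that is with
  \<open>y = - id\<close>, and it gives the same conclusion because \<open>v\<close> may be replaced by \<open>- v\<close>.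

  If \<open>0\<close> were outside the weak-star closure of \<open>K\<close>, some \<open>u\<close> would satisfy \<open>T u \<ge> \<delta> > 0\<close> for all
  \<open>T \<in> K\<close> (\<open>weak_star_separation_from_0\<close>), and the support function of \<open>J\<close> would be negative at
  \<open>- u\<close>. The functional on the dual space that separates is automatically an evaluation, because a
  basic weak-star neighbourhood of \<open>0\<close> only involves finitely many vectors \<open>v\<^sub>1, \<dots>, v\<^sub>n\<close>: the
  image of \<open>K\<close> under \<open>T \<mapsto> (T v\<^sub>1, \<dots>, T v\<^sub>n)\<close> stays away from the origin of a Euclidean space,
  and the point \<open>w\<close> of its closure nearest to the origin gives \<open>u = \<Sum> w\<^sub>i v\<^sub>i\<close>. As the number \<open>n\<close>
  is not known in advance, the nearest point is constructed by hand from a minimizing sequence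
  (\<open>convex_image_separation_from_0\<close>).
\<close>

section \<open>Separation from the origin\<close>

text \<open>
  A minimizing sequence for \<open>\<Sum>i\<in>F. (f i T)\<^sup>2\<close> over \<open>K\<close> is Cauchy in each coordinate by the
  parallelogram identity, since midpoints stay in \<open>K\<close>. Its limit \<open>w\<close> need not be the image of a
  point of \<open>K\<close>, but it minimizes the norm over the closure of the image, and the first-order
  condition at \<open>w\<close> is the variational inequality \<open>\<Sum>i\<in>F. w i * (f i S - w i) \<ge> 0\<close>.
\<close>

lemma convex_image_separation_from_0:
  fixes f :: "'i \<Rightarrow> 'b::real_vector \<Rightarrow> real"
  assumes lin: "\<And>i. i \<in> F \<Longrightarrow> linear (f i)" and fin: "finite F"
    and conv: "convex K" and ne: "K \<noteq> {}"
    and away: "\<And>T. T \<in> K \<Longrightarrow> \<delta> \<le> (\<Sum>i\<in>F. (f i T)\<^sup>2)"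
  shows "\<exists>w. \<forall>S\<in>K. \<delta> \<le> (\<Sum>i\<in>F. w i * f i S)"
proof -
  define q where "q T = (\<Sum>i\<in>F. (f i T)\<^sup>2)" for T
  define d where "d = Inf (q ` K)"
  have bdd: "bdd_below (q ` K)"
    using away by (auto simp: q_def intro!: bdd_belowI[of _ \<delta>])
  have q_ge: "d \<le> q T" if "T \<in> K" for T
    unfolding d_def using bdd that by (intro cINF_lower)
  have "\<delta> \<le> d"
    unfolding d_def using ne away by (intro cINF_greatest) (auto simp: q_def)
  have "\<exists>T\<in>K. q T < d + 1 / real (Suc k)" for k
    using cINF_less_iff[OF ne bdd, of "d + 1 / real (Suc k)"] by (simp add: d_def)
  then obtain T where TK: "\<And>k. T k \<in> K" and Tq: "\<And>k. q (T k) < d + 1 / real (Suc k)"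
    by metis
  have null: "(\<lambda>k. 1 / real (Suc k)) \<longlonglongrightarrow> 0"
    using LIMSEQ_inverse_real_of_nat by (simp add: inverse_eq_divide)
  have comb: "f i ((1 - s) *\<^sub>R A + s *\<^sub>R B) = (1 - s) * f i A + s * f i B" if "i \<in> F" for i s A B
    using lin[OF that] by (simp add: linear_add linear_scale)
  have "(\<Sum>i\<in>F. (f i (T k) - f i (T l))\<^sup>2) \<le> 2 * (1 / real (Suc k) + 1 / real (Suc l))" for k l
  proof -
    let ?M = "(1 - 1/2) *\<^sub>R T k + (1/2) *\<^sub>R T l"
    have "?M \<in> K"
      using convexD_alt[OF conv TK TK, of "1/2"] by simp
    then have "d \<le> q ?M"
      by (rule q_ge)
    also have "4 * q ?M = (\<Sum>i\<in>F. (f i (T k) + f i (T l))\<^sup>2)"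
      unfolding q_def sum_distrib_left
      by (intro sum.cong refl) (simp only: comb, simp add: power2_eq_square algebra_simps)
    finally have "4 * d \<le> (\<Sum>i\<in>F. (f i (T k) + f i (T l))\<^sup>2)"
      using \<open>d \<le> q ?M\<close> by linarith
    moreover have "(\<Sum>i\<in>F. (f i (T k) - f i (T l))\<^sup>2) + (\<Sum>i\<in>F. (f i (T k) + f i (T l))\<^sup>2)
        = 2 * q (T k) + 2 * q (T l)"
      unfolding q_def sum_distrib_left sum.distrib[symmetric]
      by (intro sum.cong refl) (simp add: power2_eq_square algebra_simps)
    ultimately show ?thesis
      using Tq[of k] Tq[of l] by argo
  qed
  then have coord: "(f i (T k) - f i (T l))\<^sup>2 \<le> 2 * (1 / real (Suc k) + 1 / real (Suc l))"
    if "i \<in> F" for i k l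
    using member_le_sum[of i F "\<lambda>i. (f i (T k) - f i (T l))\<^sup>2"] fin that
    by (meson order_trans zero_le_power2)
  have "Cauchy (\<lambda>k. f i (T k))" if i: "i \<in> F" for i
  proof (rule metric_CauchyI)
    fix e :: real assume "0 < e"
    then have "\<forall>\<^sub>F k in sequentially. 1 / real (Suc k) < e\<^sup>2 / 4"
      by (intro order_tendstoD(2)[OF null]) simp
    then obtain N where N: "\<And>k. k \<ge> N \<Longrightarrow> 1 / real (Suc k) < e\<^sup>2 / 4"
      by (auto simp: eventually_sequentially)
    have "dist (f i (T k)) (f i (T l)) < e" if "k \<ge> N" "l \<ge> N" for k l
    proof -
      have "\<bar>f i (T k) - f i (T l)\<bar>\<^sup>2 < e\<^sup>2"
        using coord[OF i, of k l] N[OF that(1)] N[OF that(2)] by (simp only: power2_abs) argo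
      then show ?thesis
        unfolding dist_real_def using \<open>0 < e\<close> by (rule power2_less_imp_less[OF _ less_imp_le])
    qed
    then show "\<exists>N. \<forall>k\<ge>N. \<forall>l\<ge>N. dist (f i (T k)) (f i (T l)) < e"
      by blast
  qed
  then have "\<forall>i\<in>F. \<exists>a. (\<lambda>k. f i (T k)) \<longlonglongrightarrow> a"
    by (simp add: Cauchy_convergent_iff convergent_def)
  then obtain w where w: "\<And>i. i \<in> F \<Longrightarrow> (\<lambda>k. f i (T k)) \<longlonglongrightarrow> w i"
    by metis
  have "(\<lambda>k. q (T k)) \<longlonglongrightarrow> (\<Sum>i\<in>F. (w i)\<^sup>2)"
    unfolding q_def by (intro tendsto_intros w)
  moreover have "(\<lambda>k. q (T k)) \<longlonglongrightarrow> d"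
  proof (rule tendsto_sandwich[OF _ _ tendsto_const])
    show "(\<lambda>k. d + 1 / real (Suc k)) \<longlonglongrightarrow> d"
      using tendsto_add[OF tendsto_const[of d] null] by simp
  qed (intro always_eventually allI q_ge TK less_imp_le[OF Tq])+
  ultimately have w_norm: "(\<Sum>i\<in>F. (w i)\<^sup>2) = d"
    by (rule LIMSEQ_unique)
  have "d \<le> (\<Sum>i\<in>F. w i * f i S)" if S: "S \<in> K" for S
  proof -
    define c where "c = (\<Sum>i\<in>F. w i * (f i S - w i))"
    define r where "r = (\<Sum>i\<in>F. (f i S - w i)\<^sup>2)"
    have "0 \<le> 2 * c + s * r" if s: "0 < s" "s < 1" for s
    proof -
      have "d \<le> q ((1 - s) *\<^sub>R T k + s *\<^sub>R S)" for k
        using s by (intro q_ge convexD_alt[OF conv TK S]) auto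
      then have "d \<le> (\<Sum>i\<in>F. ((1 - s) * f i (T k) + s * f i S)\<^sup>2)" for k
        by (simp add: q_def comb)
      moreover have "(\<lambda>k. \<Sum>i\<in>F. ((1 - s) * f i (T k) + s * f i S)\<^sup>2)
          \<longlonglongrightarrow> (\<Sum>i\<in>F. ((1 - s) * w i + s * f i S)\<^sup>2)"
        by (intro tendsto_intros w)
      ultimately have "d \<le> (\<Sum>i\<in>F. ((1 - s) * w i + s * f i S)\<^sup>2)"
        by (intro LIMSEQ_le_const) auto
      also have "\<dots> = (\<Sum>i\<in>F. (w i)\<^sup>2) + s * (2 * c + s * r)"
        unfolding c_def r_def sum_distrib_left sum.distrib[symmetric]
        by (intro sum.cong refl) (simp add: power2_eq_square algebra_simps)
      finally have "0 \<le> s * (2 * c + s * r)"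
        by (simp add: w_norm)
      then show ?thesis
        using s by (simp add: zero_le_mult_iff)
    qed
    then have "\<forall>\<^sub>F s in at_right 0. 0 \<le> 2 * c + s * r"
      by (auto simp: eventually_at_right_field intro!: exI[of _ 1])
    moreover have "((\<lambda>s. 2 * c + s * r) \<longlongrightarrow> 2 * c + 0 * r) (at_right 0)"
      by (intro tendsto_intros)
    ultimately have "0 \<le> 2 * c + 0 * r"
      by (intro tendsto_lowerbound) auto
    moreover have "c = (\<Sum>i\<in>F. w i * f i S) - d"
      unfolding c_def w_norm[symmetric] sum_subtractf[symmetric]
      by (intro sum.cong refl) (simp add: power2_eq_square algebra_simps)
    ultimately show ?thesis
      by simp
  qed
  with \<open>\<delta> \<le> d\<close> show ?thesis
    by (meson order_trans)
qed

lemma weak_star_neighbourhood_0: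
  fixes N :: "('a::real_normed_vector \<Rightarrow>\<^sub>L real) set"
  assumes "openin weak_star_topology N" and "0 \<in> N"
  obtains F e where "finite F" and "0 < e" and "\<And>T. (\<And>v. v \<in> F \<Longrightarrow> \<bar>blinfun_apply T v\<bar> < e) \<Longrightarrow> T \<in> N"
proof -
  obtain G where G: "open G" "N = blinfun_apply -` G"
    using assms(1) by (auto simp: strong_operator_topology_def openin_pullback_topology)
  have "openin (product_topology (\<lambda>i::'a. euclidean) UNIV) G" and "(\<lambda>v. 0) \<in> G"
    using G assms(2) by (auto simp: open_fun_def zero_blinfun.rep_eq)
  from product_topology_open_contains_basis[OF this]
  obtain X :: "'a \<Rightarrow> real set" where X0: "(\<lambda>v. 0) \<in> (\<Pi>\<^sub>E v\<in>UNIV. X v)"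
    and Xo: "\<And>v. open (X v)" and Xf: "finite {v. X v \<noteq> UNIV}" and XG: "(\<Pi>\<^sub>E v\<in>UNIV. X v) \<subseteq> G"
    by auto
  have "\<exists>e>0. ball 0 e \<subseteq> X v" for v
    using Xo[of v] X0 by (auto simp: open_contains_ball PiE_iff)
  then obtain e where e: "\<And>v. 0 < e v" "\<And>v. ball 0 (e v) \<subseteq> X v"
    by metis
  define F where "F = {v. X v \<noteq> UNIV}"
  \<comment> \<open>The element \<open>1\<close> makes the minimum meaningful when \<open>F\<close> is empty.\<close>
  define e0 where "e0 = Min (insert 1 (e ` F))"
  have "finite F"
    using Xf by (simp add: F_def)
  moreover from this have "0 < e0"
    by (simp add: e0_def e)
  moreover have "T \<in> N" if T: "\<And>v. v \<in> F \<Longrightarrow> \<bar>blinfun_apply T v\<bar> < e0" for T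
  proof -
    have "T v \<in> X v" for v
    proof (cases "v \<in> F")
      case True
      then have "e0 \<le> e v"
        using \<open>finite F\<close> by (simp add: e0_def)
      then have "T v \<in> ball 0 (e v)"
        using T[OF True] by simp
      then show ?thesis
        using e(2) by blast
    qed (simp add: F_def)
    then show ?thesis
      using XG by (auto simp: G PiE_iff)
  qed
  ultimately show ?thesis
    using that by blast
qed

text \<open>
  The separating vector is the combination of the finitely many vectors describing a neighbourhood
  of \<open>0\<close> that misses \<open>K\<close>, with the coordinates of the nearest point as coefficients.
\<close>

lemma weak_star_separation_from_0:
  fixes K :: "('a::real_normed_vector \<Rightarrow>\<^sub>L real) set"
  assumes "convex K" and "K \<noteq> {}" and "0 \<notin> weak_star_topology closure_of K"
  obtains u \<delta> where "0 < \<delta>" and "\<And>T. T \<in> K \<Longrightarrow> \<delta> \<le> blinfun_apply T u"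
proof -
  obtain N where N: "openin weak_star_topology N" "0 \<in> N" and miss: "\<And>T. T \<in> K \<Longrightarrow> T \<notin> N"
    using assms(3) by (auto simp: in_closure_of strong_operator_topology_topspace)
  obtain F e where F: "finite F" "0 < e" "\<And>T. (\<And>v. v \<in> F \<Longrightarrow> \<bar>blinfun_apply T v\<bar> < e) \<Longrightarrow> T \<in> N"
    by (rule weak_star_neighbourhood_0[OF N]) blast
  have "e\<^sup>2 \<le> (\<Sum>v\<in>F. (blinfun_apply T v)\<^sup>2)" if "T \<in> K" for T
  proof -
    have "\<exists>v\<in>F. e \<le> \<bar>T v\<bar>"
      using F(3) miss[OF that] by (meson not_le)
    then obtain v where v: "v \<in> F" "e \<le> \<bar>T v\<bar>"
      by blast
    then have "e\<^sup>2 \<le> (T v)\<^sup>2"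
      using \<open>0 < e\<close> by (simp add: abs_le_square_iff[symmetric])
    also have "\<dots> \<le> (\<Sum>v\<in>F. (T v)\<^sup>2)"
      using v F(1) by (intro member_le_sum) auto
    finally show ?thesis .
  qed
  moreover have "linear (\<lambda>T. blinfun_apply T v)" for v :: 'a
    by (intro linearI) (simp_all add: blinfun.bilinear_simps)
  ultimately obtain w where w: "\<And>T. T \<in> K \<Longrightarrow> e\<^sup>2 \<le> (\<Sum>v\<in>F. w v * blinfun_apply T v)"
    using convex_image_separation_from_0[of F "\<lambda>v T. blinfun_apply T v" K "e\<^sup>2"] F(1) assms(1,2)
    by blast
  show ?thesis
  proof (rule that)
    show "0 < e\<^sup>2"
      using \<open>0 < e\<close> by simp
    show "e\<^sup>2 \<le> T (\<Sum>v\<in>F. w v *\<^sub>R v)" if "T \<in> K" for T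
      using w[OF that] by (simp add: blinfun.sum_right blinfun.scaleR_right)
  qed
qed

section \<open>Directional derivatives at an extremum\<close>

lemma upper_dini_local_min_nonneg:
  fixes \<psi> :: "'a::real_normed_vector \<Rightarrow> real"
  assumes "open U" and "x0 \<in> U" and min: "\<forall>\<^sub>F x in at x0 within U. \<psi> x0 \<le> \<psi> x"
  shows "0 \<le> upper_dini \<psi> x0 v"
proof -
  have "\<forall>\<^sub>F x in nhds x0. \<psi> x0 \<le> \<psi> x"
    using min unfolding at_within_open[OF assms(2,1)] eventually_at_filter
    by (rule eventually_mono) auto
  moreover have "((\<lambda>t. x0 + t *\<^sub>R v) \<longlongrightarrow> x0) (at_right 0)"
    by (auto intro!: tendsto_eq_intros)
  ultimately have "\<forall>\<^sub>F t in at_right 0. \<psi> x0 \<le> \<psi> (x0 + t *\<^sub>R v)"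
    by (rule eventually_compose_filterlim)
  moreover have "\<forall>\<^sub>F t::real in at_right 0. 0 < t"
    by (simp add: eventually_at_right_less)
  ultimately have "\<forall>\<^sub>F t in at_right 0. 0 \<le> ereal ((\<psi> (x0 + t *\<^sub>R v) - \<psi> x0) / t)"
    by eventually_elim simp
  then show ?thesis
    unfolding upper_dini_def by (intro le_Limsup) auto
qed

text \<open>
  Local extrema of either kind are covered at once: \<open>y\<close> is \<open>id\<close> at a minimum of \<open>\<phi>\<close> and
  \<open>- id\<close> at a maximum.
\<close>

lemma local_min_SUP_nonneg:
  fixes y :: "real \<Rightarrow>\<^sub>L real"
  assumes "open U" and "x0 \<in> U" and "pseudo_Jacobian \<phi> x0 J"
    and "\<forall>\<^sub>F x in at x0 within U. y (\<phi> x0) \<le> y (\<phi> x)"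
  shows "0 \<le> (SUP T\<in>J. ereal (y (blinfun_apply T v)))"
proof -
  have "0 \<le> upper_dini (blinfun_apply y \<circ> \<phi>) x0 v"
    using assms(4) by (intro upper_dini_local_min_nonneg[OF assms(1,2)]) simp
  also have "\<dots> \<le> (SUP T\<in>J. ereal (y (blinfun_apply T v)))"
    using assms(3) unfolding pseudo_Jacobian_def by blast
  finally show ?thesis .
qed

theorem theorem2p10:
  fixes \<phi> :: "'a::banach \<Rightarrow> real" and U :: "'a set" and x0 :: 'a
    and J :: "('a \<Rightarrow>\<^sub>L real) set"
  assumes "open U" and "x0 \<in> U"
    and "local_extremum_on \<phi> U x0"
    and "pseudo_Jacobian \<phi> x0 J"
  shows "0 \<in> weak_star_closed_convex_hull J"
proof (rule ccontr)
  assume "0 \<notin> weak_star_closed_convex_hull J"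
  moreover have "J \<noteq> {}"
    using assms(4) by (simp add: pseudo_Jacobian_def)
  ultimately obtain u \<delta> where "0 < \<delta>" and u: "\<And>T. T \<in> convex hull J \<Longrightarrow> \<delta> \<le> blinfun_apply T u"
    using weak_star_separation_from_0[of "convex hull J"]
    unfolding weak_star_closed_convex_hull_def by (metis convex_convex_hull convex_hull_eq_empty)
  have "0 \<le> (SUP T\<in>J. ereal (blinfun_apply T (- u)))"
    using assms(3) unfolding local_extremum_on_def
  proof
    assume "\<forall>\<^sub>F x in at x0 within U. \<phi> x0 \<le> \<phi> x"
    then show ?thesis
      using local_min_SUP_nonneg[OF assms(1,2,4), of id_blinfun "- u"] by simp
  next
    assume "\<forall>\<^sub>F x in at x0 within U. \<phi> x \<le> \<phi> x0"
    then show ?thesis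
      using local_min_SUP_nonneg[OF assms(1,2,4), of "- id_blinfun" u]
      by (simp add: blinfun.bilinear_simps)
  qed
  also have "\<dots> \<le> ereal (- \<delta>)"
    using u by (intro SUP_least) (auto simp: blinfun.bilinear_simps hull_inc)
  finally show False
    using \<open>0 < \<delta>\<close> by simp
qed

end
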